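(* Let $\Omega$ be a compact domain in $\mathbb{R}^d$ with boundary $\Gamma$, let $L$ be a linear differential operator, and let $U$ be a linear space of functions, continuous on $\Omega$, that solve the homogeneous equation $Lu=0$ in $\Omega$. Consider the problem of finding $u\in U$ from its Dirichlet boundary values $D(u):=u_{|_\Gamma}\in C(\Gamma)$, and assume that the Maximum Principle is satisfied, so that the problem is well-posed in the sense that $$\|u\|_{\infty,\Omega}\le\|u\|_{\infty,\Gamma}\quad\text{for all }u\in U .$$ Then uniform stability can be guaranteed by a sufficiently fine set of test points on the boundary: there is a constant $C$ such that for every finite-dimensional trial space $U_r\subset U$ of homogeneous solutions there is a finite set $X_r\subset\Gamma$ of test points with $$\|u_r\|_{\infty,\Gamma}\le C\,\|u_r\|_{\infty,X_r}\quad\text{for all }u_r\in U_r,$$ where $C$ does not depend on the trial space $U_r$.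
   Context: For a set $S$, $\|u\|_{\infty,S}:=\sup_{x\in S}|u(x)|$. The data space is $F=C(\Gamma)$ with the sup norm, and $D:U\to F$ is the data map. For a finite-dimensional trial space $U_r\subset U$ with $F_r:=D(U_r)$ and a sampling map $T_s:F\to V_s$ into a finite-dimensional space, a stability inequality is an inequality $\|f_r\|_F\le C_{r,s}\|T_s(f_r)\|_{V_s}$ for all $f_r\in F_r$. Uniform stability means that the constants $C_{r,s}$ can be bounded independently of the trial space and the sampling. Here the sampling map takes the values at the finitely many test points of $X_r$, and $V_s$ carries the maximum norm. *)

theory Defs
  imports "HOL-Analysis.Analysis" "HOL-Library.Function_Algebras"
begin

instantiation "fun" :: (type, real_vector) real_vector
begin

definition scaleR_fun :: "real \<Rightarrow> ('a \<Rightarrow> 'b) \<Rightarrow> 'a \<Rightarrow> 'b"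
  where "scaleR_fun c f = (\<lambda>x. c *\<^sub>R f x)"

instance
  by standard (simp_all add: scaleR_fun_def fun_eq_iff scaleR_add_right scaleR_add_left)

end

(* The supremum is taken in the reals, so the value is meaningful only if S is nonempty
   and u is bounded on S. *)
definition sup_norm :: "'a set \<Rightarrow> ('a \<Rightarrow> real) \<Rightarrow> real"
  where "sup_norm S u = (SUP x\<in>S. \<bar>u x\<bar>)"

(* A compact domain is the closure of a nonempty, bounded, connected open set; since the
   interior of such a closure is again connected, that set can be taken to be the interior. *)
definition compact_domain :: "(real^'d) set \<Rightarrow> bool"
  where "compact_domain \<Omega> \<longleftrightarrow>
    compact \<Omega> \<and> interior \<Omega> \<noteq> {} \<and> connected (interior \<Omega>) \<and> closure (interior \<Omega>) = \<Omega>"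

primrec partial_derivs :: "'d list \<Rightarrow> (real^'d \<Rightarrow> real) \<Rightarrow> real^'d \<Rightarrow> real"
  where
    "partial_derivs [] u = u"
  | "partial_derivs (i # is) u =
       (\<lambda>x. frechet_derivative (partial_derivs is u) (at x) (axis i 1))"

(* Intended for open S. *)
definition continuously_diff_on :: "nat \<Rightarrow> (real^'d) set \<Rightarrow> (real^'d \<Rightarrow> real) \<Rightarrow> bool"
  where "continuously_diff_on m S u \<longleftrightarrow>
    (\<forall>is. length is < m \<longrightarrow> (\<forall>x\<in>S. partial_derivs is u differentiable (at x))) \<and>
    (\<forall>is. length is \<le> m \<longrightarrow> continuous_on S (partial_derivs is u))"

(* Multi-indices are encoded as lists of coordinate directions. On C^m functions the order
   of differentiation is irrelevant, so these are exactly the operators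
   Lu = sum over |alpha| <= m of a_alpha D^alpha u. *)
definition linear_differential_operator ::
    "nat \<Rightarrow> (real^'d) set \<Rightarrow> ((real^'d \<Rightarrow> real) \<Rightarrow> real^'d \<Rightarrow> real) \<Rightarrow> bool"
  where "linear_differential_operator m G L \<longleftrightarrow>
    (\<exists>a :: 'd list \<Rightarrow> real^'d \<Rightarrow> real.
       \<forall>u. continuously_diff_on m G u \<longrightarrow>
         (\<forall>x\<in>G. L u x = (\<Sum>is | length is \<le> m. a is x * partial_derivs is u x)))"

(* A function on \<Omega> is represented by its extension by zero, so that linear
   (in)dependence and dimension refer to the functions on \<Omega> only. *)
definition homogeneous_solutions ::
    "nat \<Rightarrow> (real^'d) set \<Rightarrow> ((real^'d \<Rightarrow> real) \<Rightarrow> real^'d \<Rightarrow> real) \<Rightarrow> (real^'d \<Rightarrow> real) set"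
  where "homogeneous_solutions m \<Omega> L =
    {u. (\<forall>x. x \<notin> \<Omega> \<longrightarrow> u x = 0) \<and> continuous_on \<Omega> u \<and>
        continuously_diff_on m (interior \<Omega>) u \<and> (\<forall>x\<in>interior \<Omega>. L u x = 0)}"

definition finite_dim_subspace :: "'a::real_vector set \<Rightarrow> bool"
  where "finite_dim_subspace V \<longleftrightarrow> (\<exists>B. finite B \<and> V = span B)"

end

theory Submission
  imports Defs
begin

text \<open>
  Solutions are continuous up to the boundary, so a trial space restricts to a finite-dimensional
  space \<open>V\<close> of continuous functions on the compact set \<open>\<Gamma>\<close>, and the task is to show that such a space
  admits finitely many test points with a constant that does not depend on \<open>V\<close>.

  As \<open>V\<close> is finite-dimensional, there are finitely many nodes \<open>X\<close> in \<open>\<Gamma>\<close> and continuous cardinal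
  functions \<open>l x\<close> with \<open>u y = (\<Sum>x\<in>X. u x * l x y)\<close> for all \<open>u\<close> in \<open>V\<close> and \<open>y\<close> in \<open>\<Gamma>\<close>
  (\<open>lagrange_basis_exists\<close>). By itself this yields a stability inequality whose constant is the
  Lebesgue constant of the nodes, which depends on \<open>V\<close>. However, it also controls how fast the
  functions in \<open>V\<close> vary: if \<open>M\<close> bounds \<open>\<bar>u\<bar>\<close> on \<open>X\<close>, then
  \<open>\<bar>u y - u z\<bar> \<le> M * (\<Sum>x\<in>X. \<bar>l x y - l x z\<bar>)\<close>. By compactness there is a finite set \<open>Y\<close> of further
  test points such that every \<open>y\<close> in \<open>\<Gamma>\<close> has a \<open>z\<close> in \<open>Y\<close> for which the last sum is less than 1
  (\<open>finite_net_for_continuous_family\<close>). If \<open>M\<close> is the maximum of \<open>\<bar>u\<bar>\<close> on \<open>X \<union> Y\<close>, it follows that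
  \<open>\<bar>u y\<bar> \<le> \<bar>u z\<bar> + M \<le> 2 * M\<close>. Hence the constant 2 serves every \<open>V\<close>; the dependence on \<open>V\<close> has
  moved from the constant into the choice of the test points.
\<close>

lemma abs_le_sup_norm:
  assumes "finite X" "x \<in> X"
  shows "\<bar>u x\<bar> \<le> sup_norm X u"
  unfolding sup_norm_def using assms by (intro cSUP_upper bdd_above_finite) auto

text \<open>
  The reproducing formula and the continuity of the \<open>l x\<close> are what the stability estimate uses.
  The cardinality condition is carried along for the inductive construction: it makes the
  interpolation error of a further function vanish at the nodes already chosen.
\<close>

definition lagrange_basis ::
    "'a::topological_space set \<Rightarrow> ('a \<Rightarrow> real) set \<Rightarrow> 'a set \<Rightarrow> ('a \<Rightarrow> 'a \<Rightarrow> real) \<Rightarrow> bool"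
  where "lagrange_basis S V X l \<longleftrightarrow>
    finite X \<and> X \<subseteq> S \<and> (\<forall>x\<in>X. continuous_on S (l x)) \<and>
    (\<forall>x\<in>X. \<forall>y\<in>X. l x y = (if x = y then 1 else 0)) \<and>
    (\<forall>u\<in>V. \<forall>y\<in>S. u y = (\<Sum>x\<in>X. u x * l x y))"

text \<open>
  The nodes are built by Newton's scheme: when the space is enlarged by \<open>b\<close>, the interpolation
  error \<open>r\<close> of \<open>b\<close> either vanishes on \<open>S\<close>, and the old nodes suffice, or is nonzero at some point,
  which becomes the new node. The new cardinal function is \<open>r\<close>, scaled to be 1 there, and subtracting
  multiples of it makes the old ones vanish there.
\<close>

lemma lagrange_basis_exists:
  fixes B :: "('a::topological_space \<Rightarrow> real) set"
  assumes "finite B" and "\<And>b. b \<in> B \<Longrightarrow> continuous_on S b"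
  shows "\<exists>X l. lagrange_basis S (span B) X l"
  using assms
proof (induction B rule: finite_induct)
  case empty
  show ?case by (rule exI[of _ "{}"]) (simp add: lagrange_basis_def)
next
  case (insert b B)
  obtain X l where "lagrange_basis S (span B) X l"
    using insert.IH insert.prems by blast
  then have fin: "finite X" and XS: "X \<subseteq> S"
    and cont: "\<And>x. x \<in> X \<Longrightarrow> continuous_on S (l x)"
    and card: "\<And>x y. x \<in> X \<Longrightarrow> y \<in> X \<Longrightarrow> l x y = (if x = y then 1 else 0)"
    and rep: "\<And>u y. u \<in> span B \<Longrightarrow> y \<in> S \<Longrightarrow> u y = (\<Sum>x\<in>X. u x * l x y)"
    unfolding lagrange_basis_def by blast+
  have contb: "continuous_on S b" using insert.prems by blast
  define r where "r = (\<lambda>y. b y - (\<Sum>x\<in>X. b x * l x y))"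
  have contr: "continuous_on S r"
    unfolding r_def by (intro continuous_intros contb cont)
  have rX: "r y = 0" if "y \<in> X" for y
  proof -
    have "(\<Sum>x\<in>X. b x * l x y) = (\<Sum>x\<in>X. if x = y then b x else 0)"
      by (rule sum.cong) (use that card in auto)
    then show ?thesis using that fin by (simp add: r_def)
  qed
  \<comment> \<open>The interpolation error of every function of the enlarged space is a multiple of \<open>r\<close>.\<close>
  have err: "\<exists>k. \<forall>y\<in>S. u y = (\<Sum>x\<in>X. u x * l x y) + k * r y"
    if u: "u \<in> span (insert b B)" for u
  proof -
    obtain k where k: "u - k *\<^sub>R b \<in> span B" using u unfolding span_insert by blast
    have "u y = (\<Sum>x\<in>X. u x * l x y) + k * r y" if "y \<in> S" for y
      using rep[OF k that]
      by (simp add: r_def scaleR_fun_def fun_diff_def algebra_simps sum_subtractf sum_distrib_left)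
    then show ?thesis by blast
  qed
  show ?case
  proof (cases "\<forall>y\<in>S. r y = 0")
    case True
    have "\<forall>u\<in>span (insert b B). \<forall>y\<in>S. u y = (\<Sum>x\<in>X. u x * l x y)"
    proof (intro ballI)
      fix u y assume "u \<in> span (insert b B)" "y \<in> S"
      moreover from this obtain k where "\<forall>y\<in>S. u y = (\<Sum>x\<in>X. u x * l x y) + k * r y"
        using err by blast
      ultimately have "u y = (\<Sum>x\<in>X. u x * l x y) + k * r y" by blast
      then show "u y = (\<Sum>x\<in>X. u x * l x y)" using True \<open>y \<in> S\<close> by simp
    qed
    with fin XS cont card have "lagrange_basis S (span (insert b B)) X l"
      by (simp add: lagrange_basis_def)
    then show ?thesis by blast
  next
    case False
    then obtain z where z: "z \<in> S" "r z \<noteq> 0" by blast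
    have zX: "z \<notin> X" using rX z by blast
    define l' where
      "l' = (\<lambda>x y. if x = z then r y / r z else l x y - l x z * (r y / r z))"
    have "continuous_on S (l' x)" if "x \<in> insert z X" for x
    proof (cases "x = z")
      case True
      then show ?thesis unfolding l'_def
        using z by (simp, intro continuous_intros contr) simp
    next
      case False
      with that have "x \<in> X" by simp
      then show ?thesis unfolding l'_def
        using False z by (simp, intro continuous_intros contr cont) simp_all
    qed
    moreover have "l' x y = (if x = y then 1 else 0)" if "x \<in> insert z X" "y \<in> insert z X" for x y
      using that z rX card zX unfolding l'_def by auto
    moreover have "u y = (\<Sum>x\<in>insert z X. u x * l' x y)"
      if u: "u \<in> span (insert b B)" and y: "y \<in> S" for u y
    proof -
      obtain k where k: "\<And>y. y \<in> S \<Longrightarrow> u y = (\<Sum>x\<in>X. u x * l x y) + k * r y"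
        using err[OF u] by blast
      have "(\<Sum>x\<in>X. u x * l' x y) = (\<Sum>x\<in>X. u x * l x y - u x * l x z * (r y / r z))"
        using zX by (intro sum.cong) (auto simp: l'_def algebra_simps)
      also have "\<dots> = (\<Sum>x\<in>X. u x * l x y) - (\<Sum>x\<in>X. u x * l x z) * (r y / r z)"
        by (simp only: sum_subtractf sum_distrib_right)
      also have "\<dots> = (u y - k * r y) - (u z - k * r z) * (r y / r z)"
        using k[OF y] k[OF z(1)] by simp
      also have "\<dots> = u y - u z * (r y / r z)"
        using z(2) by (simp add: field_simps)
      finally show ?thesis
        using fin zX by (simp add: l'_def)
    qed
    ultimately have "lagrange_basis S (span (insert b B)) (insert z X) l'"
      unfolding lagrange_basis_def using fin XS z(1) by blast
    then show ?thesis by blast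
  qed
qed

text \<open>
  This is where the test points become fine. Each point of \<open>S\<close> has a neighbourhood on which the
  whole finite family varies little, and finitely many of these cover \<open>S\<close>.
\<close>

lemma finite_net_for_continuous_family:
  fixes l :: "'i \<Rightarrow> 'a::topological_space \<Rightarrow> real"
  assumes "compact S" "finite X" "\<And>x. x \<in> X \<Longrightarrow> continuous_on S (l x)" "e > 0"
  obtains Y where "finite Y" "Y \<subseteq> S"
    "\<And>y. y \<in> S \<Longrightarrow> \<exists>z\<in>Y. (\<Sum>x\<in>X. \<bar>l x y - l x z\<bar>) < e"
proof -
  have "\<exists>N. open N \<and> z \<in> N \<and> (\<forall>y\<in>N \<inter> S. (\<Sum>x\<in>X. \<bar>l x y - l x z\<bar>) < e)" if z: "z \<in> S" for z
  proof -
    have "continuous_on S (\<lambda>y. \<Sum>x\<in>X. \<bar>l x y - l x z\<bar>)"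
      by (intro continuous_intros assms)
    then have "((\<lambda>y. \<Sum>x\<in>X. \<bar>l x y - l x z\<bar>) \<longlongrightarrow> 0) (at z within S)"
      using z by (auto simp: continuous_on_def)
    then have "\<forall>\<^sub>F y in at z within S. (\<Sum>x\<in>X. \<bar>l x y - l x z\<bar>) < e"
      using \<open>e > 0\<close> by (rule order_tendstoD)
    then obtain N where N: "open N" "z \<in> N"
      "\<And>y. y \<in> N \<Longrightarrow> y \<noteq> z \<Longrightarrow> y \<in> S \<Longrightarrow> (\<Sum>x\<in>X. \<bar>l x y - l x z\<bar>) < e"
      unfolding eventually_at_topological by blast
    have "(\<Sum>x\<in>X. \<bar>l x y - l x z\<bar>) < e" if "y \<in> N \<inter> S" for y
      using that N(3)[of y] \<open>e > 0\<close> by (cases "y = z") simp_all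
    with N(1,2) show ?thesis by blast
  qed
  then obtain N where N: "\<And>z. z \<in> S \<Longrightarrow> open (N z)" "\<And>z. z \<in> S \<Longrightarrow> z \<in> N z"
    "\<And>z y. z \<in> S \<Longrightarrow> y \<in> N z \<Longrightarrow> y \<in> S \<Longrightarrow> (\<Sum>x\<in>X. \<bar>l x y - l x z\<bar>) < e"
    by (metis IntI)
  have "S \<subseteq> (\<Union>z\<in>S. N z)" using N(2) by blast
  then obtain Y where "Y \<subseteq> S" "finite Y" "S \<subseteq> (\<Union>z\<in>Y. N z)"
    using compactE_image[OF \<open>compact S\<close>, of S N] N(1) by metis
  with N(3) show ?thesis by (intro that[of Y]) blast+
qed

lemma uniformly_stable_test_points:
  fixes B :: "('a::topological_space \<Rightarrow> real) set"
  assumes "compact S" "S \<noteq> {}" "finite B" "\<And>b. b \<in> B \<Longrightarrow> continuous_on S b"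
  shows "\<exists>X. finite X \<and> X \<noteq> {} \<and> X \<subseteq> S \<and> (\<forall>u\<in>span B. sup_norm S u \<le> 2 * sup_norm X u)"
proof -
  obtain X l where "lagrange_basis S (span B) X l"
    using lagrange_basis_exists[OF assms(3,4)] by blast
  then have fin: "finite X" and XS: "X \<subseteq> S"
    and cont: "\<And>x. x \<in> X \<Longrightarrow> continuous_on S (l x)"
    and rep: "\<And>u y. u \<in> span B \<Longrightarrow> y \<in> S \<Longrightarrow> u y = (\<Sum>x\<in>X. u x * l x y)"
    unfolding lagrange_basis_def by blast+
  obtain Y where Y: "finite Y" "Y \<subseteq> S"
    and near: "\<And>y. y \<in> S \<Longrightarrow> \<exists>z\<in>Y. (\<Sum>x\<in>X. \<bar>l x y - l x z\<bar>) < 1"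
    by (rule finite_net_for_continuous_family[of S X l 1])
      (use \<open>compact S\<close> fin cont in simp_all)
  have finXY: "finite (X \<union> Y)" using fin Y by simp
  have "sup_norm S u \<le> 2 * sup_norm (X \<union> Y) u" if u: "u \<in> span B" for u
  proof -
    let ?M = "sup_norm (X \<union> Y) u"
    have "\<bar>u y\<bar> \<le> 2 * ?M" if y: "y \<in> S" for y
    proof -
      obtain z where z: "z \<in> Y" and less: "(\<Sum>x\<in>X. \<bar>l x y - l x z\<bar>) < 1" using near[OF y] by blast
      have zM: "\<bar>u z\<bar> \<le> ?M" using abs_le_sup_norm[OF finXY] z by blast
      have "u y - u z = (\<Sum>x\<in>X. u x * (l x y - l x z))"
        unfolding right_diff_distrib sum_subtractf
        using rep[OF u y] rep[OF u subsetD[OF Y(2) z]] by (rule arg_cong2)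
      also have "\<bar>\<dots>\<bar> \<le> (\<Sum>x\<in>X. \<bar>u x\<bar> * \<bar>l x y - l x z\<bar>)"
        by (rule order_trans[OF sum_abs]) (simp add: abs_mult)
      also have "\<dots> \<le> (\<Sum>x\<in>X. ?M * \<bar>l x y - l x z\<bar>)"
        using abs_le_sup_norm[OF finXY] by (intro sum_mono mult_right_mono) auto
      also have "\<dots> = ?M * (\<Sum>x\<in>X. \<bar>l x y - l x z\<bar>)"
        by (simp add: sum_distrib_left)
      also have "\<dots> \<le> ?M * 1"
        using less zM by (intro mult_left_mono) auto
      finally show ?thesis using zM by linarith
    qed
    then show ?thesis
      unfolding sup_norm_def[of S] using \<open>S \<noteq> {}\<close> by (intro cSUP_least)
  qed
  moreover have "Y \<noteq> {}" using near \<open>S \<noteq> {}\<close> by blast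
  ultimately show ?thesis
    using finXY XS Y(2) by (intro exI[of _ "X \<union> Y"]) auto
qed

theorem theorem5:
  fixes \<Omega> \<Gamma> :: "(real^'d) set"
    and L :: "(real^'d \<Rightarrow> real) \<Rightarrow> real^'d \<Rightarrow> real"
    and m :: nat
    and U :: "(real^'d \<Rightarrow> real) set"
  assumes "compact_domain \<Omega>"
    and "\<Gamma> = frontier \<Omega>"
    and "linear_differential_operator m (interior \<Omega>) L"
    and "subspace U"
    and "U \<subseteq> homogeneous_solutions m \<Omega> L"
    and "\<forall>u\<in>U. sup_norm \<Omega> u \<le> sup_norm \<Gamma> u"
  shows "\<exists>C::real. \<forall>Ur. Ur \<subseteq> U \<and> finite_dim_subspace Ur \<longrightarrow>
    (\<exists>X. finite X \<and> X \<noteq> {} \<and> X \<subseteq> \<Gamma> \<and>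
      (\<forall>u\<in>Ur. sup_norm \<Gamma> u \<le> C * sup_norm X u))"
proof (intro exI[of _ 2] allI impI)
  fix Ur assume Ur: "Ur \<subseteq> U \<and> finite_dim_subspace Ur"
  then obtain B where B: "finite B" "Ur = span B" unfolding finite_dim_subspace_def by blast
  have comp: "compact \<Omega>" and ne: "\<Omega> \<noteq> {}"
    using assms(1) by (auto simp: compact_domain_def)
  have "\<Omega> \<noteq> UNIV" using comp not_bounded_UNIV compact_imp_bounded by metis
  then have "\<Gamma> \<noteq> {}" using ne assms(2) by (simp add: frontier_eq_empty)
  moreover have "compact \<Gamma>" using assms(2) comp by (simp add: compact_frontier)
  moreover have "continuous_on \<Gamma> b" if "b \<in> B" for b
  proof -
    have "b \<in> homogeneous_solutions m \<Omega> L"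
      using that B Ur assms(5) span_superset[of B] by blast
    then have "continuous_on \<Omega> b" by (simp add: homogeneous_solutions_def)
    then show ?thesis
      using assms(2) comp by (metis continuous_on_subset compact_imp_closed frontier_subset_closed)
  qed
  ultimately show "\<exists>X. finite X \<and> X \<noteq> {} \<and> X \<subseteq> \<Gamma> \<and> (\<forall>u\<in>Ur. sup_norm \<Gamma> u \<le> 2 * sup_norm X u)"
    unfolding B(2) using B(1) by (intro uniformly_stable_test_points)
qed

end
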